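(* Let $\Gamma$ be a finitely generated group, $K$ a finite generating set of $\Gamma$, $m$ a weight on $K$, $B$ a strictly convex Banach space, $\pi$ a linear isometric action of $\Gamma$ on $B$ without non-zero invariant vectors, and $1\le r\le\infty$. Let $\mathcal{A}(\pi)$ be the set of affine isometric actions of $\Gamma$ on $B$ whose linear part is $\pi$. Then the following are equivalent. (i) Every $\alpha\in\mathcal{A}(\pi)$ has a fixed point. (ii) For every $\alpha\in\mathcal{A}(\pi)$ there is a constant $C>0$ such that every $v\in B$ with $F_{\alpha,r}(v)>0$ satisfies $|\nabla_{-}F_{\alpha,r}|(v)\ge C$. Furthermore, in (ii), $C$ can be taken to be a constant independent of $\alpha$ (that is, if the equivalent conditions hold, then there is a single $C>0$ that works for all $\alpha\in\mathcal{A}(\pi)$).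
   Context: Banach spaces are real or complex. A Banach space $(B,\|\cdot\|)$ is strictly convex if $\|v+u\|<2$ for all $v\neq u$ in $B$ with $\|v\|\le 1$, $\|u\|\le 1$. A weight on $K$ is a function $m:K\to(0,\infty)$ with $\sum_{\gamma\in K}m(\gamma)=1$. A linear isometric action $\pi$ of $\Gamma$ on $B$ is a homomorphism from $\Gamma$ to the group of surjective linear isometries of $B$; it has no non-zero invariant vectors if $\pi(\gamma)v=v$ for all $\gamma\in\Gamma$ implies $v=0$. An affine isometric action $\alpha$ of $\Gamma$ on $B$ with linear part $\pi$ is an action of the form $\alpha(\gamma,v)=\pi(\gamma)v+c(\gamma)$, where $c:\Gamma\to B$ satisfies $c(\gamma\gamma')=\pi(\gamma)c(\gamma')+c(\gamma)$ for all $\gamma,\gamma'\in\Gamma$. A fixed point of $\alpha$ is $v\in B$ with $\alpha(\gamma,v)=v$ for all $\gamma\in\Gamma$. For $v\in B$ define the displacement function $$F_{\alpha,r}(v)=\Big(\sum_{\gamma\in K}\|\alpha(\gamma,v)-v\|^r m(\gamma)\Big)^{1/r}\ (1\le r<\infty),\qquad F_{\alpha,\infty}(v)=\max_{\gamma\in K}\|\alpha(\gamma,v)-v\|.$$ Its absolute gradient at $v\in B$ is $$|\nabla_{-}F_{\alpha,r}|(v)=\max\Big\{\limsup_{u\to v,\ u\in B}\frac{F_{\alpha,r}(v)-F_{\alpha,r}(u)}{\|v-u\|},\ 0\Big\},$$ where the limsup is over $u\neq v$. *)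

theory Defs
  imports "HOL-Analysis.Analysis" "HOL-Algebra.Generated_Groups"
begin

text \<open>
  Norm-compatible scalar multiplication on a real normed space, with scalars in a field of class
  \<^class>\<open>real_normed_field\<close>.  By the Gelfand--Mazur theorem the only such fields are the reals and
  the complex numbers, so for a type of class \<^class>\<open>banach\<close> this locale describes exactly the real
  and the complex Banach spaces.
\<close>

locale scalar_normed_space = vector_space smul
  for smul :: "'k::real_normed_field \<Rightarrow> 'b::real_normed_vector \<Rightarrow> 'b" +
  assumes scale_of_real: "smul (of_real a) v = a *\<^sub>R v"
    and norm_scale: "norm (smul k v) = norm k * norm v"

lemma scalar_normed_space_real:
  "scalar_normed_space (scaleR :: real \<Rightarrow> 'b::real_normed_vector \<Rightarrow> 'b)"
  by unfold_locales (simp_all add: scaleR_add_right scaleR_add_left)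

lemma scalar_normed_space_complex:
  "scalar_normed_space ((*) :: complex \<Rightarrow> complex \<Rightarrow> complex)"
  by unfold_locales (simp_all add: algebra_simps norm_mult scaleR_conv_of_real)

definition strictly_convex :: "'b::real_normed_vector itself \<Rightarrow> bool" where
  "strictly_convex _ \<longleftrightarrow>
     (\<forall>v u :: 'b. v \<noteq> u \<longrightarrow> norm v \<le> 1 \<longrightarrow> norm u \<le> 1 \<longrightarrow> norm (v + u) < 2)"

definition weight_on :: "'g set \<Rightarrow> ('g \<Rightarrow> real) \<Rightarrow> bool" where
  "weight_on K m \<longleftrightarrow> (\<forall>\<gamma>\<in>K. m \<gamma> > 0) \<and> (\<Sum>\<gamma>\<in>K. m \<gamma>) = 1"

definition linear_isometry_group ::
    "('k::real_normed_field \<Rightarrow> 'b::real_normed_vector \<Rightarrow> 'b) \<Rightarrow> ('b \<Rightarrow> 'b) monoid" where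
  "linear_isometry_group smul =
     \<lparr>carrier = {T. Vector_Spaces.linear smul smul T \<and> (\<forall>v. norm (T v) = norm v) \<and> surj T},
      mult = (\<circ>), one = id\<rparr>"

definition linear_isometric_action ::
    "('g, 'x) monoid_scheme \<Rightarrow> ('k::real_normed_field \<Rightarrow> 'b::real_normed_vector \<Rightarrow> 'b)
       \<Rightarrow> ('g \<Rightarrow> 'b \<Rightarrow> 'b) \<Rightarrow> bool" where
  "linear_isometric_action G smul \<pi> \<longleftrightarrow> \<pi> \<in> hom G (linear_isometry_group smul)"

definition no_nonzero_invariant_vectors ::
    "('g, 'x) monoid_scheme \<Rightarrow> ('g \<Rightarrow> 'b::real_normed_vector \<Rightarrow> 'b) \<Rightarrow> bool" where
  "no_nonzero_invariant_vectors G \<pi> \<longleftrightarrow> (\<forall>v. (\<forall>\<gamma>\<in>carrier G. \<pi> \<gamma> v = v) \<longrightarrow> v = 0)"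

definition cocycle ::
    "('g, 'x) monoid_scheme \<Rightarrow> ('g \<Rightarrow> 'b::real_normed_vector \<Rightarrow> 'b) \<Rightarrow> ('g \<Rightarrow> 'b) \<Rightarrow> bool" where
  "cocycle G \<pi> c \<longleftrightarrow>
     (\<forall>\<gamma>\<in>carrier G. \<forall>\<gamma>'\<in>carrier G. c (\<gamma> \<otimes>\<^bsub>G\<^esub> \<gamma>') = \<pi> \<gamma> (c \<gamma>') + c \<gamma>)"

text \<open>Values of an action outside the carrier of the group are irrelevant and left unconstrained.\<close>

definition affine_isometric_actions ::
    "('g, 'x) monoid_scheme \<Rightarrow> ('g \<Rightarrow> 'b::real_normed_vector \<Rightarrow> 'b) \<Rightarrow> ('g \<Rightarrow> 'b \<Rightarrow> 'b) set" where
  "affine_isometric_actions G \<pi> =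
     {\<alpha>. \<exists>c. cocycle G \<pi> c \<and> (\<forall>\<gamma>\<in>carrier G. \<forall>v. \<alpha> \<gamma> v = \<pi> \<gamma> v + c \<gamma>)}"

definition fixed_point ::
    "('g, 'x) monoid_scheme \<Rightarrow> ('g \<Rightarrow> 'b \<Rightarrow> 'b) \<Rightarrow> 'b \<Rightarrow> bool" where
  "fixed_point G \<alpha> v \<longleftrightarrow> (\<forall>\<gamma>\<in>carrier G. \<alpha> \<gamma> v = v)"

definition displacement ::
    "'g set \<Rightarrow> ('g \<Rightarrow> real) \<Rightarrow> ereal \<Rightarrow> ('g \<Rightarrow> 'b::real_normed_vector \<Rightarrow> 'b) \<Rightarrow> 'b \<Rightarrow> real" where
  "displacement K m r \<alpha> v =
     (if r = \<infinity> then Max ((\<lambda>\<gamma>. norm (\<alpha> \<gamma> v - v)) ` K)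
      else (\<Sum>\<gamma>\<in>K. norm (\<alpha> \<gamma> v - v) powr real_of_ereal r * m \<gamma>) powr (1 / real_of_ereal r))"

definition absolute_gradient :: "('b::real_normed_vector \<Rightarrow> real) \<Rightarrow> 'b \<Rightarrow> ereal" where
  "absolute_gradient F v = max (Limsup (at v) (\<lambda>u. ereal ((F v - F u) / norm (v - u)))) 0"

end

theory Submission
  imports Defs
begin

text \<open>
  If the absolute gradient of the displacement function is bounded below by \<open>C > 0\<close> wherever the
  function is positive, then Caristi's argument, applied with slope \<open>C / 2\<close>, yields a point with
  displacement zero, which is fixed by the generators and hence by the group.

  Conversely, if every cocycle is a coboundary, then \<open>q v = (\<Sum>\<gamma>\<in>K. \<parallel>\<pi> \<gamma> v - v\<parallel>)\<close> is a second
  complete norm on \<open>B\<close>, dominated by the given one; by the open mapping argument the two norms are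
  equivalent.  Around a fixed point \<open>v\<^sub>0\<close> the displacement is positively homogeneous and
  dominates \<open>q (v - v\<^sub>0)\<close>, so it decreases at a rate bounded below along the segment
  from \<open>v\<close> to \<open>v\<^sub>0\<close>, and the bound depends only on \<open>\<pi>\<close>.
\<close>

section \<open>Descent in complete metric spaces\<close>

text \<open>Caristi-Ekeland argument: reachability by drops of slope at least \<open>c\<close> is a
  partial order, and a sequence that nearly minimises \<open>f\<close> at each step converges to a
  point with nothing strictly below it. There \<open>descent\<close> excludes a positive
  value.\<close>

lemma zero_if_linear_descent:
  fixes f :: "'a::complete_space \<Rightarrow> real"
  assumes cont: "continuous_on UNIV f" and nonneg: "\<And>v. f v \<ge> 0" and c: "c > 0"
    and descent: "\<And>v. f v > 0 \<Longrightarrow> \<exists>u. u \<noteq> v \<and> c * dist v u \<le> f v - f u"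
  shows "\<exists>v. f v = 0"
proof -
  define S where "S v = {u. c * dist v u \<le> f v - f u}" for v
  have S_refl: "v \<in> S v" for v by (simp add: S_def)
  have S_trans: "w \<in> S v" if "u \<in> S v" "w \<in> S u" for u v w
  proof -
    have "c * dist v w \<le> c * dist v u + c * dist u w"
      using c dist_triangle[of v w u] by (metis distrib_left mult_le_cancel_left_pos)
    then show ?thesis using that by (auto simp: S_def)
  qed
  have bdd: "bdd_below (f ` S v)" for v
    using nonneg by (intro bdd_belowI[of _ 0]) auto
  have step: "\<exists>u. u \<in> S v \<and> f u \<le> Inf (f ` S v) + e" if "e > 0" for v e
  proof -
    have "f ` S v \<noteq> {}" using S_refl by blast
    then have "\<exists>y\<in>f ` S v. y < Inf (f ` S v) + e"
      by (rule cInf_lessD) (use that in simp)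
    then show ?thesis by (auto intro: less_imp_le)
  qed
  \<comment> \<open>The infimum over \<open>S v\<close> need not be attained, so each choice gets a
    slack, and the slacks tend to 0.\<close>
  define nxt where "nxt n v = (SOME u. u \<in> S v \<and> f u \<le> Inf (f ` S v) + inverse (real (Suc n)))" for n v
  have nxt: "nxt n v \<in> S v \<and> f (nxt n v) \<le> Inf (f ` S v) + inverse (real (Suc n))" for n v
    unfolding nxt_def by (rule someI_ex, rule step) simp
  \<comment> \<open>Any starting point will do, hence \<open>undefined\<close>.\<close>
  define x where "x = rec_nat undefined nxt"
  have x_Suc: "x (Suc n) = nxt n (x n)" for n by (simp add: x_def)
  have x_mono: "x n \<in> S (x k)" if "k \<le> n" for k n
    using that by (induction n rule: dec_induct) (auto simp: x_Suc intro: S_refl S_trans nxt[THEN conjunct1])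
  have "decseq (\<lambda>n. f (x n))"
  proof (rule decseq_SucI)
    fix n
    have "0 \<le> c * dist (x n) (x (Suc n))" using c by simp
    then show "f (x (Suc n)) \<le> f (x n)" using x_mono[of n "Suc n"] by (simp add: S_def)
  qed
  then have "convergent (\<lambda>n. f (x n))"
    using decseq_convergent[of "\<lambda>n. f (x n)" 0] nonneg by (metis convergentI)
  then have Cf: "Cauchy (\<lambda>n. f (x n))" by (rule convergent_Cauchy)
  \<comment> \<open>Distances along the sequence are at most \<open>1 / c\<close> times the drops of
    \<open>f\<close>, whose values converge.\<close>
  have "Cauchy x"
  proof (rule metric_CauchyI)
    fix e :: real assume "e > 0"
    with Cf c obtain N where N: "\<And>k n. k \<ge> N \<Longrightarrow> n \<ge> N \<Longrightarrow> dist (f (x k)) (f (x n)) < c * e"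
      unfolding Cauchy_def by (meson mult_pos_pos)
    have *: "dist (x k) (x n) < e" if "N \<le> k" "k \<le> n" for k n
    proof -
      have "c * dist (x k) (x n) \<le> f (x k) - f (x n)" using x_mono[OF that(2)] by (simp add: S_def)
      also have "\<dots> < c * e" using N[of k n] that by (auto simp: dist_real_def)
      finally show ?thesis using c by simp
    qed
    show "\<exists>N. \<forall>k\<ge>N. \<forall>n\<ge>N. dist (x k) (x n) < e"
      by (metis * dist_commute linorder_linear)
  qed
  then obtain y where y: "x \<longlonglongrightarrow> y" using Cauchy_convergent convergent_def by blast
  have fy: "(\<lambda>n. f (x n)) \<longlonglongrightarrow> f y"
    using cont y by (metis UNIV_I continuous_on_def tendsto_at_iff_tendsto_nhds tendsto_compose)
  \<comment> \<open>\<open>S (x k)\<close> is closed by continuity of \<open>f\<close> and contains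
    the tail of the sequence.\<close>
  have yS: "y \<in> S (x k)" for k
  proof -
    have "(\<lambda>n. c * dist (x k) (x n)) \<longlonglongrightarrow> c * dist (x k) y"
      and "(\<lambda>n. f (x k) - f (x n)) \<longlonglongrightarrow> f (x k) - f y"
      by (intro tendsto_intros y fy)+
    moreover have "\<exists>N. \<forall>n\<ge>N. c * dist (x k) (x n) \<le> f (x k) - f (x n)"
      using x_mono by (auto simp: S_def)
    ultimately show ?thesis unfolding S_def using LIMSEQ_le by blast
  qed
  have "f y = 0"
  proof (rule ccontr)
    assume "f y \<noteq> 0"
    then have "f y > 0" using nonneg[of y] by simp
    then obtain u where u: "u \<noteq> y" "c * dist y u \<le> f y - f u" using descent by blast
    then have uS: "u \<in> S (x n)" for n using yS S_trans by (auto simp: S_def)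
    \<comment> \<open>Since \<open>u\<close> competes in every infimum, \<open>f u\<close> cannot
      undercut the limit \<open>f y\<close>, although descent made it strictly smaller.\<close>
    have le: "f (x (Suc n)) - inverse (real (Suc n)) \<le> f u" for n
      using nxt[of n "x n"] cInf_lower[OF imageI[OF uS[of n], of f] bdd] by (simp add: x_Suc)
    have "(\<lambda>n. f (x (Suc n)) - inverse (real (Suc n))) \<longlonglongrightarrow> f y - 0"
      by (intro tendsto_diff LIMSEQ_Suc[OF fy] LIMSEQ_inverse_real_of_nat)
    then have "f y \<le> f u" using le LIMSEQ_le_const2[of _ "f y" "f u"] by auto
    moreover have "c * dist y u > 0" using u c by simp
    ultimately show False using u by linarith
  qed
  then show ?thesis by blast
qed

section \<open>Comparison of two complete norms\<close>

text \<open>Open mapping argument for the identity from \<open>norm\<close> to \<open>q\<close>,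
  continuous by \<open>le_norm\<close>. Baire's theorem in the \<open>q\<close>-metric makes a norm
  ball \<open>q\<close>-dense in some \<open>q\<close>-ball; completeness of \<open>norm\<close>
  then turns approximation into equality by a geometric series.\<close>

lemma norm_le_of_complete_norm:
  fixes q :: "'b::banach \<Rightarrow> real"
  assumes triangle: "\<And>x y. q (x + y) \<le> q x + q y"
    and scale: "\<And>a x. q (a *\<^sub>R x) = \<bar>a\<bar> * q x"
    and definite: "\<And>x. q x = 0 \<Longrightarrow> x = 0"
    and le_norm: "\<And>x. q x \<le> M * norm x"
    and complete: "\<And>s::nat \<Rightarrow> 'b. (\<And>e. e > 0 \<Longrightarrow> \<exists>N. \<forall>k\<ge>N. \<forall>n\<ge>N. q (s k - s n) < e)
                     \<Longrightarrow> \<exists>x. (\<lambda>n. q (s n - x)) \<longlonglongrightarrow> 0"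
  shows "\<exists>C>0. \<forall>x. norm x \<le> C * q x"
proof -
  have q0: "q 0 = 0" using scale[of 0 0] by simp
  have q_minus: "q (- x) = q x" for x using scale[of "-1" x] by simp
  have q_nonneg: "q x \<ge> 0" for x using triangle[of x "-x"] q0 q_minus by simp
  have q_commute: "q (x - y) = q (y - x)" for x y using q_minus[of "x - y"] by simp
  have q_tri: "q (x - z) \<le> q (x - y) + q (y - z)" for x y z using triangle[of "x - y" "y - z"] by simp
  \<comment> \<open>The set-based metric spaces let the \<open>q\<close>-metric stand beside the
    metric of the type class.\<close>
  interpret Q: Metric_space UNIV "\<lambda>x y. q (x - y)"
  proof
    show "q (x - y) = 0 \<longleftrightarrow> x = y" for x y using definite[of "x - y"] q0 by auto
    show "0 \<le> q (x - y)" "q (x - y) = q (y - x)" "q (x - z) \<le> q (x - y) + q (y - z)" for x y z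
      by (rule q_nonneg q_commute q_tri)+
  qed
  have mc: "Q.mcomplete"
    unfolding Q.mcomplete_def
  proof (intro allI impI)
    fix s :: "nat \<Rightarrow> 'b" assume "Q.MCauchy s"
    then have "\<exists>N. \<forall>k\<ge>N. \<forall>n\<ge>N. q (s k - s n) < e" if "e > 0" for e
      using that unfolding Q.MCauchy_def by meson
    then obtain x where x: "(\<lambda>n. q (s n - x)) \<longlonglongrightarrow> 0"
      using complete[of s] by metis
    have "limitin Q.mtopology s x sequentially"
      unfolding Q.limitin_metric using order_tendstoD(2)[OF x] by auto
    then show "\<exists>x. limitin Q.mtopology s x sequentially" ..
  qed
  \<comment> \<open>The \<open>q\<close>-closures of the norm balls cover the space, so one of them
    has \<open>q\<close>-interior.\<close>
  define A where "A n = Q.mtopology closure_of {x. norm x \<le> real n}" for n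
  have A_iff: "x \<in> A n \<longleftrightarrow> (\<forall>e>0. \<exists>y. norm y \<le> real n \<and> q (x - y) < e)" for x n
    unfolding A_def Q.metric_closure_of by auto
  have "(\<Union>n. A n) = UNIV"
  proof -
    have "x \<in> A (nat \<lceil>norm x\<rceil>)" for x
      unfolding A_iff using q0 by (auto intro!: exI[of _ x] real_nat_ceiling_ge)
    then show ?thesis by blast
  qed
  then have "Q.mtopology interior_of (\<Union>(range A)) \<noteq> {}"
    using interior_of_topspace[of Q.mtopology] by simp
  moreover have "closedin Q.mtopology (A n)" for n by (simp add: A_def)
  moreover have "countable (range A)" by simp
  ultimately obtain n where "Q.mtopology interior_of A n \<noteq> {}"
    using Q.metric_Baire_category_alt[OF mc, of "range A"] by blast
  then obtain x0 d where d: "d > 0" and "Q.mball x0 d \<subseteq> A n"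
    unfolding Q.metric_interior_of by blast
  then have ball: "x \<in> A n" if "q (x0 - x) < d" for x
    using that by (auto simp: subset_iff)
  \<comment> \<open>The \<open>q\<close>-ball moves from \<open>x0\<close> to 0: \<open>x\<close> is
    half the difference of \<open>x0 + x\<close> and \<open>x0 - x\<close>, and half the difference
    of two vectors of a norm ball stays in that ball.\<close>
  have near0: "\<exists>y. norm y \<le> real n \<and> q (x - y) < e" if "q x < d" "e > 0" for x e
  proof -
    have "x0 + x \<in> A n" "x0 - x \<in> A n" using ball that(1) q_minus by auto
    with \<open>e > 0\<close> obtain y z where y: "norm y \<le> real n" "q (x0 + x - y) < e"
      and z: "norm z \<le> real n" "q (x0 - x - z) < e"
      unfolding A_iff by meson
    define w where "w = (1/2) *\<^sub>R (y - z)"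
    have "norm w \<le> real n" using y z norm_triangle_ineq4[of y z] by (simp add: w_def)
    moreover have "x - w = (1/2) *\<^sub>R ((x0 + x - y) + - (x0 - x - z))"
      by (simp add: w_def algebra_simps flip: scaleR_add_left)
    then have "q (x - w) = 1/2 * q ((x0 + x - y) + - (x0 - x - z))"
      using scale[of "1/2"] by simp
    then have "q (x - w) < e"
      using triangle[of "x0 + x - y" "- (x0 - x - z)"] q_minus[of "x0 - x - z"] y z by linarith
    ultimately show ?thesis by blast
  qed
  \<comment> \<open>The same at scale \<open>t\<close>: a vector of norm at most
    \<open>t * n\<close> halves the bound \<open>t * d\<close> on the
    \<open>q\<close>-error.\<close>
  have approx: "\<exists>y. norm y \<le> t * real n \<and> q (x - y) < t * d / 2" if "q x < t * d" "t > 0" for x t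
  proof -
    have "q ((1/t) *\<^sub>R x) < d" using that by (simp add: scale field_simps)
    then obtain y where y: "norm y \<le> real n" "q ((1/t) *\<^sub>R x - y) < d / 2"
      using near0[of "(1/t) *\<^sub>R x" "d/2"] d by auto
    have "q (x - t *\<^sub>R y) = t * q ((1/t) *\<^sub>R x - y)"
      using scale[of t "(1/t) *\<^sub>R x - y"] that by (simp add: scaleR_diff_right)
    then show ?thesis using y that by (intro exI[of _ "t *\<^sub>R y"]) auto
  qed
  \<comment> \<open>Iterating \<open>approx\<close> with \<open>t = (1/2)^k\<close> writes
    \<open>x\<close> as a norm-convergent series of corrections whose norms add up to at most
    \<open>2 * n\<close>.\<close>
  have small: "norm x \<le> 2 * real n" if x: "q x < d" for x
  proof -
    define pick where "pick k y = (SOME w. norm w \<le> (1/2)^k * real n \<and> q (y - w) < (1/2)^k * d / 2)" for k y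
    have pick: "norm (pick k y) \<le> (1/2)^k * real n \<and> q (y - pick k y) < (1/2)^k * d / 2"
      if "q y < (1/2)^k * d" for k y
      unfolding pick_def by (rule someI_ex, rule approx) (use that in auto)
    define res where "res = rec_nat x (\<lambda>k y. y - pick k y)"
    have res_Suc: "res (Suc k) = res k - pick k (res k)" and res_0: "res 0 = x" for k
      by (simp_all add: res_def)
    have res: "q (res k) < (1/2)^k * d" for k
      by (induction k) (use x res_0 res_Suc pick in auto)
    define w where "w k = pick k (res k)" for k
    have w: "norm (w k) \<le> (1/2)^k * real n" for k using pick[OF res] by (simp add: w_def)
    have sums_geo: "(\<lambda>k. (1/2)^k * real n) sums (2 * real n)"
      using sums_mult2[OF geometric_sums[of "1/2::real"], of "real n"] by simp
    have sw': "summable (\<lambda>k. norm (w k))"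
      by (rule summable_comparison_test'[OF sums_summable[OF sums_geo], of 0]) (simp add: w)
    then have sw: "summable w" by (rule summable_norm_cancel)
    have part: "(\<Sum>k<N. w k) = x - res N" for N
      by (induction N) (simp_all add: res_0 res_Suc w_def)
    \<comment> \<open>The partial sums tend to \<open>x\<close> in \<open>q\<close> by construction
      and to \<open>suminf w\<close> in \<open>norm\<close>, hence in \<open>q\<close> by
      \<open>le_norm\<close>.\<close>
    have "q (x - suminf w) \<le> 0"
    proof (rule LIMSEQ_le_const)
      have "(\<lambda>N. (1/2)^N * d + M * norm ((\<Sum>k<N. w k) - suminf w)) \<longlonglongrightarrow> 0 * d + M * 0"
        using summable_LIMSEQ[OF sw]
        by (intro tendsto_intros LIMSEQ_power_zero tendsto_norm_zero) (auto simp: LIM_zero)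
      then show "(\<lambda>N. (1/2)^N * d + M * norm ((\<Sum>k<N. w k) - suminf w)) \<longlonglongrightarrow> 0" by simp
      have "q (x - suminf w) \<le> (1/2)^N * d + M * norm ((\<Sum>k<N. w k) - suminf w)" for N
        using q_tri[of x "suminf w" "\<Sum>k<N. w k"] res[of N] le_norm[of "(\<Sum>k<N. w k) - suminf w"]
        by (simp add: part)
      then show "\<exists>K. \<forall>N\<ge>K. q (x - suminf w) \<le> (1/2)^N * d + M * norm ((\<Sum>k<N. w k) - suminf w)"
        by blast
    qed
    then have "x = suminf w" using definite[of "x - suminf w"] q_nonneg[of "x - suminf w"] by simp
    also have "norm \<dots> \<le> (\<Sum>k. norm (w k))" by (rule summable_norm[OF sw'])
    also have "\<dots> \<le> (\<Sum>k. (1/2)^k * real n)" by (rule suminf_le[OF w sw' sums_summable[OF sums_geo]])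
    finally show ?thesis using sums_unique[OF sums_geo] by simp
  qed
  \<comment> \<open>The factor \<open>4 * n / d\<close> comes from rescaling \<open>x\<close> to
    \<open>q\<close>-length \<open>d / 2\<close>, strictly inside the ball of \<open>small\<close>.
    The summand 1 keeps \<open>C\<close> positive when \<open>n\<close> is 0.\<close>
  define C where "C = 4 * real n / d + 1"
  have "norm x \<le> C * q x" for x
  proof (cases "q x = 0")
    case True then show ?thesis using definite by simp
  next
    case False
    then have pos: "q x > 0" using q_nonneg[of x] by simp
    have "norm ((d / (2 * q x)) *\<^sub>R x) \<le> 2 * real n"
      using pos d by (intro small) (simp add: scale)
    then have "norm x \<le> (4 * real n / d) * q x" using pos d by (simp add: field_simps)
    then show ?thesis using pos by (simp add: C_def algebra_simps)
  qed
  moreover have "C > 0" using d by (auto simp: C_def intro: add_nonneg_pos)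
  ultimately show ?thesis by blast
qed

section \<open>Bounds on the absolute gradient\<close>

text \<open>A limsup need not be reached by any quotient, so some slope is given away. If all
  quotients stayed below \<open>C / 2\<close>, so would the limsup, and the 0 in the maximum is
  below \<open>C / 2\<close> as well.\<close>

lemma absolute_gradient_pos_lower_bound:
  assumes "0 < C" "ereal C \<le> absolute_gradient F v"
  shows "\<exists>u. u \<noteq> v \<and> C / 2 * dist v u \<le> F v - F u"
proof (rule ccontr)
  assume neg: "\<nexists>u. u \<noteq> v \<and> C / 2 * dist v u \<le> F v - F u"
  have "(F v - F u) / norm (v - u) \<le> C / 2" if "u \<noteq> v" for u
  proof -
    have "F v - F u \<le> C / 2 * norm (v - u)" using neg that by (force simp: dist_norm)
    then show ?thesis using that by (simp add: divide_le_eq)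
  qed
  then have "Limsup (at v) (\<lambda>u. ereal ((F v - F u) / norm (v - u))) \<le> ereal (C / 2)"
    by (intro Limsup_bounded) (auto simp: eventually_at_filter)
  then have "absolute_gradient F v \<le> ereal (C / 2)"
    using assms(1) by (simp add: absolute_gradient_def)
  with assms(2) have "ereal C \<le> ereal (C / 2)" by (rule order_trans)
  with assms(1) show False by simp
qed

text \<open>On the segment from \<open>v\<close> to \<open>p\<close> the function is linear and
  falls to 0, so every quotient there equals \<open>F v / norm (v - p)\<close>. One direction of
  approach suffices for a limsup.\<close>

lemma absolute_gradient_ge_if_homogeneous:
  fixes F :: "'b::real_normed_vector \<Rightarrow> real"
  assumes homogeneous: "\<And>t w. 0 \<le> t \<Longrightarrow> F (p + t *\<^sub>R w) = t * F (p + w)"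
    and "v \<noteq> p" and lower: "C * norm (v - p) \<le> F v"
  shows "ereal C \<le> absolute_gradient F v"
proof -
  have quot: "C \<le> (F v - F u) / norm (v - u)"
    if u: "u = p + (1 - t) *\<^sub>R (v - p)" and t: "0 < t" "t \<le> 1" for u t
  proof -
    have "v - u = t *\<^sub>R (v - p)" by (simp add: u algebra_simps)
    then have "norm (v - u) = t * norm (v - p)" using t by simp
    moreover have "F v - F u = t * F v"
      using homogeneous[of "1 - t" "v - p"] t by (simp add: u algebra_simps)
    ultimately show ?thesis using t lower \<open>v \<noteq> p\<close> by (simp add: le_divide_eq)
  qed
  have "\<exists>\<^sub>F u in at v. ereal C \<le> ereal ((F v - F u) / norm (v - u))"
    unfolding frequently_at
  proof (intro allI impI)
    fix d :: real assume "d > 0"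
    \<comment> \<open>The bound 1 keeps \<open>u\<close> on the segment; the other term puts
      \<open>u\<close> within \<open>d\<close> of \<open>v\<close>.\<close>
    define t where "t = min 1 (d / (2 * norm (v - p)))"
    have np: "norm (v - p) > 0" using \<open>v \<noteq> p\<close> by simp
    have t: "0 < t" "t \<le> 1" using \<open>d > 0\<close> np by (auto simp: t_def)
    have "t * norm (v - p) \<le> d / (2 * norm (v - p)) * norm (v - p)"
      using np by (intro mult_right_mono) (auto simp: t_def)
    then have td: "t * norm (v - p) < d" using np \<open>d > 0\<close> by simp
    define u where "u = p + (1 - t) *\<^sub>R (v - p)"
    have uv: "u - v = (- t) *\<^sub>R (v - p)" by (simp add: u_def algebra_simps)
    then have "dist u v < d" using t td by (simp add: dist_norm)
    moreover have "u \<noteq> v" using uv t \<open>v \<noteq> p\<close> by auto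
    ultimately show "\<exists>u\<in>UNIV. u \<noteq> v \<and> dist u v < d \<and> ereal C \<le> ereal ((F v - F u) / norm (v - u))"
      using quot[OF u_def t] by auto
  qed
  then have "ereal C \<le> Limsup (at v) (\<lambda>u. ereal ((F v - F u) / norm (v - u)))"
    using Limsup_le_iff[of "at v" "\<lambda>u. ereal ((F v - F u) / norm (v - u))"]
    by (metis (mono_tags, lifting) frequently_def eventually_mono not_le order_refl)
  then show ?thesis by (simp add: absolute_gradient_def le_max_iff_disj)
qed

section \<open>Weighted power means over the generating set\<close>

text \<open>On nonnegative \<open>a\<close> this is the weighted l^r norm on R^K. It separates the
  analysis of the displacement function from the action.\<close>

definition weighted_mean :: "'g set \<Rightarrow> ('g \<Rightarrow> real) \<Rightarrow> ereal \<Rightarrow> ('g \<Rightarrow> real) \<Rightarrow> real" where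
  "weighted_mean K m r a =
     (if r = \<infinity> then Max (a ` K)
      else (\<Sum>\<gamma>\<in>K. a \<gamma> powr real_of_ereal r * m \<gamma>) powr (1 / real_of_ereal r))"

lemma displacement_eq_weighted_mean:
  "displacement K m r \<alpha> v = weighted_mean K m r (\<lambda>\<gamma>. norm (\<alpha> \<gamma> v - v))"
  by (simp add: displacement_def weighted_mean_def)

lemma weighted_mean_cong: "(\<And>\<gamma>. \<gamma> \<in> K \<Longrightarrow> a \<gamma> = b \<gamma>) \<Longrightarrow> weighted_mean K m r a = weighted_mean K m r b"
  unfolding weighted_mean_def by (metis (mono_tags, lifting) image_cong sum.cong)

lemma tendsto_Max:
  fixes f :: "'i \<Rightarrow> 'a \<Rightarrow> 'c::linorder_topology"
  assumes "finite K" "K \<noteq> {}" "\<And>i. i \<in> K \<Longrightarrow> (f i \<longlongrightarrow> l i) F"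
  shows "((\<lambda>x. Max ((\<lambda>i. f i x) ` K)) \<longlongrightarrow> Max (l ` K)) F"
  using assms by (induction K rule: finite_ne_induct) (auto intro: tendsto_max)

context
  fixes K :: "'g set" and m :: "'g \<Rightarrow> real" and r :: ereal
  assumes finite: "finite K" and weight: "weight_on K m" and r: "1 \<le> r"
begin

lemma weight_on_nonempty: "K \<noteq> {}"
  using weight by (auto simp: weight_on_def)

lemma exponent_ge_1: "r \<noteq> \<infinity> \<Longrightarrow> real_of_ereal r \<ge> 1"
  using r by (cases r) auto

lemma weighted_mean_nonneg: "(\<And>\<gamma>. \<gamma> \<in> K \<Longrightarrow> 0 \<le> a \<gamma>) \<Longrightarrow> 0 \<le> weighted_mean K m r a"
  using finite weight_on_nonempty by (auto simp: weighted_mean_def Max_ge_iff)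

lemma weighted_mean_scale:
  assumes t: "0 \<le> t" and a: "\<And>\<gamma>. \<gamma> \<in> K \<Longrightarrow> 0 \<le> a \<gamma>"
  shows "weighted_mean K m r (\<lambda>\<gamma>. t * a \<gamma>) = t * weighted_mean K m r a"
proof (cases "r = \<infinity>")
  case True
  have "Max ((\<lambda>x. t * x) ` (a ` K)) = t * Max (a ` K)"
    using t finite weight_on_nonempty
    by (intro mono_Max_commute[symmetric]) (auto intro: monoI mult_left_mono)
  then show ?thesis using True by (simp add: weighted_mean_def image_image)
next
  case False
  define p where "p = real_of_ereal r"
  have p: "p \<ge> 1" using exponent_ge_1[OF False] by (simp add: p_def)
  have "(\<Sum>\<gamma>\<in>K. (t * a \<gamma>) powr p * m \<gamma>) = t powr p * (\<Sum>\<gamma>\<in>K. a \<gamma> powr p * m \<gamma>)"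
    using t a by (simp add: powr_mult sum_distrib_left mult_ac)
  moreover have "(t powr p) powr (1 / p) = t" using t p by (simp add: powr_powr)
  moreover have "0 \<le> (\<Sum>\<gamma>\<in>K. a \<gamma> powr p * m \<gamma>)"
    using weight by (intro sum_nonneg) (auto simp: weight_on_def less_imp_le)
  ultimately show ?thesis using False by (simp add: weighted_mean_def powr_mult flip: p_def)
qed

text \<open>Half of the equivalence of norms on R^K: the mean dominates each single entry up to a
  factor, and averaging over \<open>K\<close> gives the sum. As \<open>c\<close> precedes
  \<open>a\<close>, it serves all actions at once.\<close>

lemma weighted_mean_ge_sum:
  "\<exists>c>0. \<forall>a. (\<forall>\<gamma>\<in>K. 0 \<le> a \<gamma>) \<longrightarrow> c * sum a K \<le> weighted_mean K m r a"
proof -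
  define p where "p = real_of_ereal r"
  \<comment> \<open>For finite \<open>r\<close>, keeping only the term of \<gamma> in the sum leaves
    the factor \<open>m \<gamma> powr (1 / p)\<close>; the minimum covers all \<gamma>.\<close>
  define c where "c = (if r = \<infinity> then 1 else Min ((\<lambda>\<gamma>. m \<gamma> powr (1 / p)) ` K))"
  have c: "c > 0"
    using finite weight_on_nonempty weight by (auto simp: c_def weight_on_def Min_gr_iff)
  have le: "c * a \<gamma> \<le> weighted_mean K m r a" if a: "\<forall>\<gamma>\<in>K. 0 \<le> a \<gamma>" and \<gamma>: "\<gamma> \<in> K" for a \<gamma>
  proof (cases "r = \<infinity>")
    case True
    then show ?thesis using finite \<gamma> by (simp add: c_def weighted_mean_def)
  next
    case False
    have p: "p \<ge> 1" using exponent_ge_1[OF False] by (simp add: p_def)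
    have mpos: "\<And>\<gamma>. \<gamma> \<in> K \<Longrightarrow> 0 < m \<gamma>" using weight by (simp add: weight_on_def)
    have "c \<le> m \<gamma> powr (1 / p)" using finite \<gamma> False by (simp add: c_def)
    then have "c * a \<gamma> \<le> m \<gamma> powr (1 / p) * a \<gamma>" using a \<gamma> by (intro mult_right_mono) auto
    also have "\<dots> = (a \<gamma> powr p * m \<gamma>) powr (1 / p)"
      using p a \<gamma> mpos[OF \<gamma>] by (simp add: powr_mult powr_powr)
    also have "\<dots> \<le> (\<Sum>\<gamma>\<in>K. a \<gamma> powr p * m \<gamma>) powr (1 / p)"
      using p mpos \<gamma> finite
      by (intro powr_mono2 member_le_sum) (auto simp: less_imp_le)
    finally show ?thesis using False by (simp add: weighted_mean_def p_def)
  qed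
  have card: "real (card K) > 0" using finite weight_on_nonempty by (simp add: card_gt_0_iff)
  have "c / card K * sum a K \<le> weighted_mean K m r a" if a: "\<forall>\<gamma>\<in>K. 0 \<le> a \<gamma>" for a
  proof -
    have "c * sum a K \<le> (\<Sum>\<gamma>\<in>K. weighted_mean K m r a)"
      unfolding sum_distrib_left using le[OF a] by (rule sum_mono)
    then show ?thesis using card by (simp add: field_simps)
  qed
  moreover have "c / card K > 0" using c card by simp
  ultimately show ?thesis by blast
qed

lemma tendsto_weighted_mean:
  assumes a: "\<And>\<gamma> x. \<gamma> \<in> K \<Longrightarrow> 0 \<le> a \<gamma> x" and lim: "\<And>\<gamma>. \<gamma> \<in> K \<Longrightarrow> (a \<gamma> \<longlongrightarrow> l \<gamma>) F"
  shows "((\<lambda>x. weighted_mean K m r (\<lambda>\<gamma>. a \<gamma> x)) \<longlongrightarrow> weighted_mean K m r l) F"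
proof (cases "r = \<infinity>")
  case True
  then show ?thesis
    using tendsto_Max[OF finite weight_on_nonempty, of a l F] lim by (simp add: weighted_mean_def)
next
  case False
  \<comment> \<open>A base may tend to 0; there continuity of \<open>powr\<close> rests on a
    positive exponent and nonnegative bases.\<close>
  then have p: "real_of_ereal r > 0" using exponent_ge_1 by fastforce
  have "0 \<le> (\<Sum>\<gamma>\<in>K. a \<gamma> x powr real_of_ereal r * m \<gamma>)" for x
    using weight by (intro sum_nonneg) (auto simp: weight_on_def less_imp_le)
  then show ?thesis
    using False p a lim
    by (auto simp: weighted_mean_def intro!: tendsto_powr2 tendsto_sum tendsto_mult_right)
qed

end

section \<open>Linear and affine isometric actions\<close>

context
  fixes G :: "('g, 'x) monoid_scheme" and smul :: "'k::real_normed_field \<Rightarrow> 'b::real_normed_vector \<Rightarrow> 'b"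
    and \<pi> :: "'g \<Rightarrow> 'b \<Rightarrow> 'b"
  assumes G: "group G" and smul: "scalar_normed_space smul"
    and action: "linear_isometric_action G smul \<pi>"
begin

lemma linear_isometric_action_isometry:
  assumes "\<gamma> \<in> carrier G"
  shows "norm (\<pi> \<gamma> v) = norm v" "surj (\<pi> \<gamma>)" "bounded_linear (\<pi> \<gamma>)"
proof -
  have mem: "Vector_Spaces.linear smul smul (\<pi> \<gamma>) \<and> (\<forall>v. norm (\<pi> \<gamma> v) = norm v) \<and> surj (\<pi> \<gamma>)"
    using action assms by (auto simp: linear_isometric_action_def linear_isometry_group_def hom_def Pi_iff)
  then show "norm (\<pi> \<gamma> v) = norm v" "surj (\<pi> \<gamma>)" by auto
  interpret L: Vector_Spaces.linear smul smul "\<pi> \<gamma>" using mem by blast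
  \<comment> \<open>Restricting scalars to the reals turns \<open>smul\<close>-linearity into the
    linearity of the type class, for which bounded operators are available.\<close>
  have "\<pi> \<gamma> (a *\<^sub>R v) = a *\<^sub>R \<pi> \<gamma> v" for a v
    using L.scale[of "of_real a" v] scalar_normed_space.scale_of_real[OF smul] by metis
  then show "bounded_linear (\<pi> \<gamma>)"
    using mem L.add by (intro bounded_linear_intro[of _ 1]) auto
qed

lemma linear_isometric_action_mult:
  "\<gamma> \<in> carrier G \<Longrightarrow> \<gamma>' \<in> carrier G \<Longrightarrow> \<pi> (\<gamma> \<otimes>\<^bsub>G\<^esub> \<gamma>') v = \<pi> \<gamma> (\<pi> \<gamma>' v)"
  using action by (auto simp: linear_isometric_action_def linear_isometry_group_def hom_def)

lemma linear_isometric_action_diff: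
  "\<gamma> \<in> carrier G \<Longrightarrow> \<pi> \<gamma> (v - w) = \<pi> \<gamma> v - \<pi> \<gamma> w"
  using linear_isometric_action_isometry(3) by (rule linear_diff[OF bounded_linear.linear])

text \<open>\<open>hom\<close> speaks of products only. The image of the unit is idempotent and
  surjective, hence the identity.\<close>

lemma linear_isometric_action_one: "\<pi> \<one>\<^bsub>G\<^esub> v = v"
proof -
  interpret group G by (rule G)
  obtain w where "v = \<pi> \<one>\<^bsub>G\<^esub> w"
    using linear_isometric_action_isometry(2)[OF one_closed] by (metis surjE)
  then show ?thesis using linear_isometric_action_mult[of "\<one>\<^bsub>G\<^esub>" "\<one>\<^bsub>G\<^esub>" w] by simp
qed

lemma linear_isometric_action_inv: "\<gamma> \<in> carrier G \<Longrightarrow> \<pi> (inv\<^bsub>G\<^esub> \<gamma>) (\<pi> \<gamma> v) = v"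
  using linear_isometric_action_mult[of "inv\<^bsub>G\<^esub> \<gamma>" \<gamma> v] G linear_isometric_action_one
  by (simp add: group.l_inv)

lemma affine_isometric_actions_mult:
  assumes "\<alpha> \<in> affine_isometric_actions G \<pi>" "\<gamma> \<in> carrier G" "\<gamma>' \<in> carrier G"
  shows "\<alpha> (\<gamma> \<otimes>\<^bsub>G\<^esub> \<gamma>') v = \<alpha> \<gamma> (\<alpha> \<gamma>' v)"
proof -
  interpret group G by (rule G)
  obtain c where "cocycle G \<pi> c" "\<And>\<gamma> v. \<gamma> \<in> carrier G \<Longrightarrow> \<alpha> \<gamma> v = \<pi> \<gamma> v + c \<gamma>"
    using assms(1) by (auto simp: affine_isometric_actions_def)
  then show ?thesis
    using assms(2,3) linear_isometric_action_mult[of \<gamma> \<gamma>' v]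
      linear_add[OF bounded_linear.linear[OF linear_isometric_action_isometry(3)[OF assms(2)]]]
    by (simp add: cocycle_def add.assoc)
qed

lemma affine_isometric_actions_one:
  assumes "\<alpha> \<in> affine_isometric_actions G \<pi>"
  shows "\<alpha> \<one>\<^bsub>G\<^esub> v = v"
proof -
  interpret group G by (rule G)
  obtain c where c: "cocycle G \<pi> c" "\<And>\<gamma> v. \<gamma> \<in> carrier G \<Longrightarrow> \<alpha> \<gamma> v = \<pi> \<gamma> v + c \<gamma>"
    using assms(1) by (auto simp: affine_isometric_actions_def)
  have "c (\<one>\<^bsub>G\<^esub> \<otimes>\<^bsub>G\<^esub> \<one>\<^bsub>G\<^esub>) = c \<one>\<^bsub>G\<^esub> + c \<one>\<^bsub>G\<^esub>"
    using c(1) linear_isometric_action_one one_closed unfolding cocycle_def by metis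
  then have "c \<one>\<^bsub>G\<^esub> = 0" by simp
  then show ?thesis using c(2) linear_isometric_action_one by simp
qed

lemma fixed_point_if_fixed_by_generators:
  assumes \<alpha>: "\<alpha> \<in> affine_isometric_actions G \<pi>" and K: "K \<subseteq> carrier G" "generate G K = carrier G"
    and fixed: "\<And>\<gamma>. \<gamma> \<in> K \<Longrightarrow> \<alpha> \<gamma> v = v"
  shows "fixed_point G \<alpha> v"
  unfolding fixed_point_def
proof
  interpret group G by (rule G)
  fix \<gamma> assume "\<gamma> \<in> carrier G"
  then have "\<gamma> \<in> generate G K" using K by simp
  then show "\<alpha> \<gamma> v = v"
  proof (induction rule: generate.induct)
    case one
    show ?case by (rule affine_isometric_actions_one[OF \<alpha>])
  next
    case (incl h)
    then show ?case by (rule fixed)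
  next
    case (inv h)
    then have h: "h \<in> carrier G" using K by blast
    then show ?case
      using affine_isometric_actions_mult[OF \<alpha>, of "inv\<^bsub>G\<^esub> h" h v] fixed[OF inv]
        affine_isometric_actions_one[OF \<alpha>, of v] by simp
  next
    case (eng h1 h2)
    then show ?case
      using affine_isometric_actions_mult[OF \<alpha>, of h1 h2 v] K by simp
  qed
qed

text \<open>\<open>M\<close> is the length of a word for \<gamma> in the generators and their
  inverses: displacements of a product telescope, and an isometry moves a vector as far as its
  inverse does. Thus control on \<open>K\<close> extends to the whole group.\<close>

lemma linear_displacement_bound:
  assumes K: "finite K" "K \<subseteq> carrier G" "generate G K = carrier G" and "\<gamma> \<in> carrier G"
  shows "\<exists>M\<ge>0. \<forall>v. norm (\<pi> \<gamma> v - v) \<le> M * (\<Sum>\<gamma>\<in>K. norm (\<pi> \<gamma> v - v))"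
proof -
  interpret group G by (rule G)
  let ?q = "\<lambda>v. \<Sum>\<gamma>\<in>K. norm (\<pi> \<gamma> v - v)"
  have K_le: "norm (\<pi> h v - v) \<le> ?q v" if "h \<in> K" for h v
    using member_le_sum[OF that, of "\<lambda>\<gamma>. norm (\<pi> \<gamma> v - v)"] K by simp
  have "\<gamma> \<in> generate G K" using assms by simp
  then show ?thesis
  proof (induction rule: generate.induct)
    case one
    show ?case by (rule exI[of _ 0]) (simp add: linear_isometric_action_one)
  next
    case (incl h)
    then show ?case using K_le by (intro exI[of _ 1]) simp
  next
    case (inv h)
    then have h: "h \<in> carrier G" using K by blast
    have "norm (\<pi> (inv\<^bsub>G\<^esub> h) v - v) = norm (\<pi> h v - v)" for v
    proof -
      have "\<pi> (inv\<^bsub>G\<^esub> h) (\<pi> h v - v) = v - \<pi> (inv\<^bsub>G\<^esub> h) v"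
        using h by (simp add: linear_isometric_action_diff linear_isometric_action_inv)
      then show ?thesis
        using linear_isometric_action_isometry(1)[OF inv_closed[OF h], of "\<pi> h v - v"]
        by (simp add: norm_minus_commute)
    qed
    then show ?case using K_le[OF inv] by (intro exI[of _ 1]) simp
  next
    case (eng h1 h2)
    then obtain M1 M2 where M: "0 \<le> M1" "\<And>v. norm (\<pi> h1 v - v) \<le> M1 * ?q v"
      "0 \<le> M2" "\<And>v. norm (\<pi> h2 v - v) \<le> M2 * ?q v" by blast
    have h: "h1 \<in> carrier G" "h2 \<in> carrier G" using eng K by auto
    have "norm (\<pi> (h1 \<otimes>\<^bsub>G\<^esub> h2) v - v) \<le> (M2 + M1) * ?q v" for v
    proof -
      have "\<pi> (h1 \<otimes>\<^bsub>G\<^esub> h2) v - v = \<pi> h1 (\<pi> h2 v - v) + (\<pi> h1 v - v)"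
        using h by (simp add: linear_isometric_action_mult linear_isometric_action_diff)
      then have "norm (\<pi> (h1 \<otimes>\<^bsub>G\<^esub> h2) v - v) \<le> norm (\<pi> h2 v - v) + norm (\<pi> h1 v - v)"
        using norm_triangle_ineq[of "\<pi> h1 (\<pi> h2 v - v)" "\<pi> h1 v - v"]
          linear_isometric_action_isometry(1)[OF h(1), of "\<pi> h2 v - v"] by metis
      then show ?thesis using M(2,4)[of v] by (simp add: distrib_right)
    qed
    then show ?case using M(1,3) by (intro exI[of _ "M2 + M1"]) auto
  qed
qed

end

section \<open>From fixed points to a spectral gap\<close>

text \<open>Fixed points say that every cocycle is a coboundary. This makes the displacement norm
  complete: the coboundaries of a Cauchy sequence converge to a cocycle, and a vector with that
  coboundary is the limit.\<close>

lemma norm_le_linear_displacement_if_fixed_points: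
  fixes smul :: "'k::real_normed_field \<Rightarrow> 'b::banach \<Rightarrow> 'b"
  assumes G: "group G" and smul: "scalar_normed_space smul"
    and action: "linear_isometric_action G smul \<pi>"
    and K: "finite K" "K \<subseteq> carrier G" "generate G K = carrier G"
    and no_inv: "no_nonzero_invariant_vectors G \<pi>"
    and fp: "\<forall>\<alpha> \<in> affine_isometric_actions G \<pi>. \<exists>v. fixed_point G \<alpha> v"
  shows "\<exists>C>0. \<forall>v. norm v \<le> C * (\<Sum>\<gamma>\<in>K. norm (\<pi> \<gamma> v - v))"
proof (rule norm_le_of_complete_norm)
  interpret group G by (rule G)
  let ?q = "\<lambda>v. \<Sum>\<gamma>\<in>K. norm (\<pi> \<gamma> v - v)"
  note iso = linear_isometric_action_isometry[OF G smul action]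
  note mult = linear_isometric_action_mult[OF G smul action]
  note diff = linear_isometric_action_diff[OF G smul action]
  note bound = linear_displacement_bound[OF G smul action K]
  have Kc: "\<gamma> \<in> carrier G" if "\<gamma> \<in> K" for \<gamma> using that K by blast
  show "?q (x + y) \<le> ?q x + ?q y" for x y
    unfolding sum.distrib[symmetric]
  proof (rule sum_mono)
    fix \<gamma> assume "\<gamma> \<in> K"
    then have "\<pi> \<gamma> (x + y) - (x + y) = (\<pi> \<gamma> x - x) + (\<pi> \<gamma> y - y)"
      using linear_add[OF bounded_linear.linear[OF iso(3)[OF Kc]]] by simp
    then show "norm (\<pi> \<gamma> (x + y) - (x + y)) \<le> norm (\<pi> \<gamma> x - x) + norm (\<pi> \<gamma> y - y)"
      by (metis norm_triangle_ineq)
  qed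
  show "?q (a *\<^sub>R x) = \<bar>a\<bar> * ?q x" for a x
    unfolding sum_distrib_left
  proof (rule sum.cong[OF refl])
    fix \<gamma> assume "\<gamma> \<in> K"
    then have "\<pi> \<gamma> (a *\<^sub>R x) - a *\<^sub>R x = a *\<^sub>R (\<pi> \<gamma> x - x)"
      using linear_scale[OF bounded_linear.linear[OF iso(3)[OF Kc]]] by (simp add: scaleR_diff_right)
    then show "norm (\<pi> \<gamma> (a *\<^sub>R x) - a *\<^sub>R x) = \<bar>a\<bar> * norm (\<pi> \<gamma> x - x)" by simp
  qed
  \<comment> \<open>A vector with zero displacement on \<open>K\<close> is invariant under the whole
    group.\<close>
  show "x = 0" if "?q x = 0" for x
  proof -
    have "\<pi> \<gamma> x = x" if "\<gamma> \<in> carrier G" for \<gamma>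
      using bound[OF that] \<open>?q x = 0\<close> by (metis eq_iff_diff_eq_0 mult_zero_right norm_le_zero_iff)
    then show ?thesis using no_inv by (simp add: no_nonzero_invariant_vectors_def)
  qed
  show "?q x \<le> (2 * card K) * norm x" for x
  proof -
    have "norm (\<pi> \<gamma> x - x) \<le> 2 * norm x" if "\<gamma> \<in> K" for \<gamma>
      using norm_triangle_ineq4[of "\<pi> \<gamma> x" x] iso(1)[OF Kc[OF that], of x] by simp
    then show ?thesis using sum_bounded_above[of K "\<lambda>\<gamma>. norm (\<pi> \<gamma> x - x)" "2 * norm x"]
      by (simp add: mult_ac)
  qed
  fix s :: "nat \<Rightarrow> 'b"
  assume Cauchy_q: "\<And>e. e > 0 \<Longrightarrow> \<exists>N. \<forall>k\<ge>N. \<forall>n\<ge>N. ?q (s k - s n) < e"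
  \<comment> \<open>The sign is such that a fixed point \<open>x\<close> of the action with cocycle
    \<open>c\<close> satisfies \<open>c \<gamma> = x - \<pi> \<gamma> x\<close>.\<close>
  define c where "c \<gamma> = lim (\<lambda>n. s n - \<pi> \<gamma> (s n))" for \<gamma>
  have c: "(\<lambda>n. s n - \<pi> \<gamma> (s n)) \<longlonglongrightarrow> c \<gamma>" if \<gamma>: "\<gamma> \<in> carrier G" for \<gamma>
  proof -
    obtain M where M: "M \<ge> 0" "\<And>v. norm (\<pi> \<gamma> v - v) \<le> M * ?q v" using bound[OF \<gamma>] by blast
    have "Cauchy (\<lambda>n. s n - \<pi> \<gamma> (s n))"
    proof (rule CauchyI)
      fix e :: real assume "e > 0"
      \<comment> \<open>\<open>M + 1\<close> replaces \<open>M\<close>, which may be 0, as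
        divisor.\<close>
      then obtain N where N: "\<And>k n. k \<ge> N \<Longrightarrow> n \<ge> N \<Longrightarrow> ?q (s k - s n) < e / (M + 1)"
        using Cauchy_q[of "e / (M + 1)"] M(1) by auto
      have "norm ((s k - \<pi> \<gamma> (s k)) - (s n - \<pi> \<gamma> (s n))) < e" if "k \<ge> N" "n \<ge> N" for k n
      proof -
        have "norm ((s k - \<pi> \<gamma> (s k)) - (s n - \<pi> \<gamma> (s n))) = norm (\<pi> \<gamma> (s k - s n) - (s k - s n))"
          using diff[OF \<gamma>] by (metis (no_types, opaque_lifting) diff_diff_eq2 add_diff_eq diff_add_eq
            minus_diff_eq norm_minus_cancel)
        also have "\<dots> \<le> M * ?q (s k - s n)" by (rule M)
        also have "\<dots> \<le> (M + 1) * ?q (s k - s n)"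
          using sum_nonneg[of K "\<lambda>\<gamma>. norm (\<pi> \<gamma> (s k - s n) - (s k - s n))"] by (simp add: distrib_right)
        also have "\<dots> < e" using N[OF that] M(1) by (simp add: pos_less_divide_eq mult.commute)
        finally show ?thesis .
      qed
      then show "\<exists>N. \<forall>k\<ge>N. \<forall>n\<ge>N. norm ((s k - \<pi> \<gamma> (s k)) - (s n - \<pi> \<gamma> (s n))) < e" by blast
    qed
    then show ?thesis unfolding c_def by (simp add: Cauchy_convergent_iff convergent_LIMSEQ_iff)
  qed
  have "cocycle G \<pi> c"
    unfolding cocycle_def
  proof (intro ballI)
    fix \<gamma> \<gamma>' assume g: "\<gamma> \<in> carrier G" "\<gamma>' \<in> carrier G"
    \<comment> \<open>The cocycle identity of the coboundaries passes to the limit because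
      \<open>\<pi> \<gamma>\<close> is continuous.\<close>
    have "(\<lambda>n. \<pi> \<gamma> (s n - \<pi> \<gamma>' (s n)) + (s n - \<pi> \<gamma> (s n))) \<longlonglongrightarrow> \<pi> \<gamma> (c \<gamma>') + c \<gamma>"
      using g c by (intro tendsto_add bounded_linear.tendsto[OF iso(3)]) auto
    moreover have "\<pi> \<gamma> (s n - \<pi> \<gamma>' (s n)) + (s n - \<pi> \<gamma> (s n)) = s n - \<pi> (\<gamma> \<otimes>\<^bsub>G\<^esub> \<gamma>') (s n)" for n
      using g by (simp add: diff mult)
    ultimately show "c (\<gamma> \<otimes>\<^bsub>G\<^esub> \<gamma>') = \<pi> \<gamma> (c \<gamma>') + c \<gamma>"
      using c[of "\<gamma> \<otimes>\<^bsub>G\<^esub> \<gamma>'"] g LIMSEQ_unique by auto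
  qed
  then have "(\<lambda>\<gamma> v. \<pi> \<gamma> v + c \<gamma>) \<in> affine_isometric_actions G \<pi>"
    by (auto simp: affine_isometric_actions_def)
  then obtain x where "fixed_point G (\<lambda>\<gamma> v. \<pi> \<gamma> v + c \<gamma>) x" using fp by blast
  then have x: "c \<gamma> = x - \<pi> \<gamma> x" if "\<gamma> \<in> carrier G" for \<gamma>
    using that by (simp add: fixed_point_def eq_diff_eq add.commute)
  have "(\<lambda>n. ?q (s n - x)) \<longlonglongrightarrow> (\<Sum>\<gamma>\<in>K. 0)"
  proof (rule tendsto_sum)
    fix \<gamma> assume "\<gamma> \<in> K"
    then have \<gamma>: "\<gamma> \<in> carrier G" by (rule Kc)
    have "(\<lambda>n. norm ((s n - \<pi> \<gamma> (s n)) - c \<gamma>)) \<longlonglongrightarrow> 0"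
      using c[OF \<gamma>] by (intro tendsto_norm_zero LIM_zero)
    moreover have "norm ((s n - \<pi> \<gamma> (s n)) - c \<gamma>) = norm (\<pi> \<gamma> (s n - x) - (s n - x))" for n
      unfolding x[OF \<gamma>] diff[OF \<gamma>] norm_minus_commute[of "_ - _ - (_ - _)" "_ - _"]
      by (subst norm_minus_cancel[symmetric]) (simp add: algebra_simps)
    ultimately show "(\<lambda>n. norm (\<pi> \<gamma> (s n - x) - (s n - x))) \<longlonglongrightarrow> 0" by simp
  qed
  then show "\<exists>x. (\<lambda>n. ?q (s n - x)) \<longlonglongrightarrow> 0" by auto
qed

section \<open>The equivalence and the uniform constant\<close>

theorem theorem1p2:
  fixes G :: "('g, 'x) monoid_scheme"
    and K :: "'g set"
    and m :: "'g \<Rightarrow> real"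
    and smul :: "'k::real_normed_field \<Rightarrow> 'b::banach \<Rightarrow> 'b"
    and \<pi> :: "'g \<Rightarrow> 'b \<Rightarrow> 'b"
    and r :: ereal
  assumes "group G"
    and "finite K" and "K \<subseteq> carrier G" and "generate G K = carrier G"
    and "weight_on K m"
    and "scalar_normed_space smul"
    and "strictly_convex TYPE('b)"
    and "linear_isometric_action G smul \<pi>"
    and "no_nonzero_invariant_vectors G \<pi>"
    and "1 \<le> r"
  shows "((\<forall>\<alpha> \<in> affine_isometric_actions G \<pi>. \<exists>v. fixed_point G \<alpha> v) \<longleftrightarrow>
          (\<forall>\<alpha> \<in> affine_isometric_actions G \<pi>. \<exists>C>0. \<forall>v.
             displacement K m r \<alpha> v > 0 \<longrightarrow>
             absolute_gradient (displacement K m r \<alpha>) v \<ge> ereal C)) \<and>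
         ((\<forall>\<alpha> \<in> affine_isometric_actions G \<pi>. \<exists>C>0. \<forall>v.
             displacement K m r \<alpha> v > 0 \<longrightarrow>
             absolute_gradient (displacement K m r \<alpha>) v \<ge> ereal C) \<longrightarrow>
          (\<exists>C>0. \<forall>\<alpha> \<in> affine_isometric_actions G \<pi>. \<forall>v.
             displacement K m r \<alpha> v > 0 \<longrightarrow>
             absolute_gradient (displacement K m r \<alpha>) v \<ge> ereal C))"
proof -
  note ctx = \<open>group G\<close> \<open>scalar_normed_space smul\<close> \<open>linear_isometric_action G smul \<pi>\<close>
  note K = \<open>finite K\<close> \<open>K \<subseteq> carrier G\<close> \<open>generate G K = carrier G\<close>
  note wm = \<open>finite K\<close> \<open>weight_on K m\<close> \<open>1 \<le> r\<close>
  note iso = linear_isometric_action_isometry[OF ctx]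
  let ?F = "displacement K m r"
  let ?fixed = "\<forall>\<alpha> \<in> affine_isometric_actions G \<pi>. \<exists>v. fixed_point G \<alpha> v"
  let ?uniform = "\<exists>C>0. \<forall>\<alpha> \<in> affine_isometric_actions G \<pi>. \<forall>v.
    ?F \<alpha> v > 0 \<longrightarrow> absolute_gradient (?F \<alpha>) v \<ge> ereal C"
  \<comment> \<open>This constant is fixed before any action is chosen, as uniformity in \<alpha>
    demands.\<close>
  obtain c where c: "c > 0"
    and mean: "\<And>a. (\<forall>\<gamma>\<in>K. 0 \<le> a \<gamma>) \<Longrightarrow> c * sum a K \<le> weighted_mean K m r a"
    using weighted_mean_ge_sum[OF wm] by blast
  let ?local = "\<forall>\<alpha> \<in> affine_isometric_actions G \<pi>. \<exists>C>0. \<forall>v.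
    ?F \<alpha> v > 0 \<longrightarrow> absolute_gradient (?F \<alpha>) v \<ge> ereal C"
  have fixed: "\<exists>v. fixed_point G \<alpha> v"
    if \<alpha>: "\<alpha> \<in> affine_isometric_actions G \<pi>" and "C > 0"
      and grad: "\<And>v. ?F \<alpha> v > 0 \<Longrightarrow> absolute_gradient (?F \<alpha>) v \<ge> ereal C" for \<alpha> C
  proof -
    obtain b where b: "\<And>\<gamma> v. \<gamma> \<in> carrier G \<Longrightarrow> \<alpha> \<gamma> v = \<pi> \<gamma> v + b \<gamma>"
      using \<alpha> by (auto simp: affine_isometric_actions_def)
    have "continuous_on UNIV (?F \<alpha>)"
      unfolding continuous_on_def displacement_eq_weighted_mean
    proof (intro ballI tendsto_weighted_mean[OF wm])
      fix v :: 'b and \<gamma> assume "\<gamma> \<in> K"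
      then have \<gamma>: "\<gamma> \<in> carrier G" using K by blast
      show "((\<lambda>v. norm (\<alpha> \<gamma> v - v)) \<longlongrightarrow> norm (\<alpha> \<gamma> v - v)) (at v within UNIV)"
        unfolding b[OF \<gamma>] by (intro tendsto_intros bounded_linear.tendsto[OF iso(3)[OF \<gamma>]])
    qed auto
    moreover have "?F \<alpha> v \<ge> 0" for v
      unfolding displacement_eq_weighted_mean by (rule weighted_mean_nonneg[OF wm]) simp
    moreover have "\<exists>u. u \<noteq> v \<and> C / 2 * dist v u \<le> ?F \<alpha> v - ?F \<alpha> u" if "?F \<alpha> v > 0" for v
      using \<open>C > 0\<close> grad[OF that] by (rule absolute_gradient_pos_lower_bound)
    moreover have "C / 2 > 0" using \<open>C > 0\<close> by simp
    ultimately obtain v where v: "?F \<alpha> v = 0"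
      using zero_if_linear_descent[of "?F \<alpha>" "C / 2"] by blast
    \<comment> \<open>A zero of the mean kills the displacement of every generator.\<close>
    then have "c * (\<Sum>\<gamma>\<in>K. norm (\<alpha> \<gamma> v - v)) \<le> 0"
      using mean[of "\<lambda>\<gamma>. norm (\<alpha> \<gamma> v - v)"] by (simp add: displacement_eq_weighted_mean)
    then have "(\<Sum>\<gamma>\<in>K. norm (\<alpha> \<gamma> v - v)) = 0"
      using c by (simp add: mult_le_0_iff order_antisym sum_nonneg)
    then have "\<And>\<gamma>. \<gamma> \<in> K \<Longrightarrow> \<alpha> \<gamma> v = v"
      using \<open>finite K\<close> by (simp add: sum_nonneg_eq_0_iff)
    then show ?thesis
      using fixed_point_if_fixed_by_generators[OF ctx \<alpha> K(2,3)] by blast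
  qed
  have uniform: ?uniform if fp: ?fixed
  proof -
    obtain C where C: "C > 0" "\<And>v. norm v \<le> C * (\<Sum>\<gamma>\<in>K. norm (\<pi> \<gamma> v - v))"
      using norm_le_linear_displacement_if_fixed_points[OF ctx K \<open>no_nonzero_invariant_vectors G \<pi>\<close> fp]
      by blast
    \<comment> \<open>\<open>c\<close> compares the mean with the sum over \<open>K\<close>, and
      \<open>C\<close> compares that sum with the norm. Both depend on \<pi>, \<open>K\<close>,
      \<open>m\<close> and \<open>r\<close> but not on \<alpha>.\<close>
    have "ereal (c / C) \<le> absolute_gradient (?F \<alpha>) v"
      if \<alpha>: "\<alpha> \<in> affine_isometric_actions G \<pi>" and pos: "?F \<alpha> v > 0" for \<alpha> v
    proof -
      obtain p where "fixed_point G \<alpha> p" using fp \<alpha> by blast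
      moreover obtain b where b: "\<And>\<gamma> v. \<gamma> \<in> carrier G \<Longrightarrow> \<alpha> \<gamma> v = \<pi> \<gamma> v + b \<gamma>"
        using \<alpha> by (auto simp: affine_isometric_actions_def)
      ultimately have p: "\<pi> \<gamma> p + b \<gamma> = p" if "\<gamma> \<in> carrier G" for \<gamma>
        using that by (simp add: fixed_point_def)
      \<comment> \<open>Taking the fixed point \<open>p\<close> as origin turns \<alpha> into its
        linear part, which gives homogeneity around \<open>p\<close>.\<close>
      have F: "?F \<alpha> (p + w) = weighted_mean K m r (\<lambda>\<gamma>. norm (\<pi> \<gamma> w - w))" for w
        unfolding displacement_eq_weighted_mean
      proof (rule weighted_mean_cong)
        fix \<gamma> assume "\<gamma> \<in> K"
        then have \<gamma>: "\<gamma> \<in> carrier G" using K by blast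
        have "\<alpha> \<gamma> (p + w) = \<pi> \<gamma> w + (\<pi> \<gamma> p + b \<gamma>)"
          using linear_add[OF bounded_linear.linear[OF iso(3)[OF \<gamma>]], of p w] b[OF \<gamma>] by simp
        then show "norm (\<alpha> \<gamma> (p + w) - (p + w)) = norm (\<pi> \<gamma> w - w)" using p[OF \<gamma>] by simp
      qed
      show ?thesis
      proof (rule absolute_gradient_ge_if_homogeneous)
        fix t :: real and w :: 'b assume t: "0 \<le> t"
        have "norm (\<pi> \<gamma> (t *\<^sub>R w) - t *\<^sub>R w) = t * norm (\<pi> \<gamma> w - w)" if "\<gamma> \<in> K" for \<gamma>
        proof -
          have "\<gamma> \<in> carrier G" using that K by blast
          then have "\<pi> \<gamma> (t *\<^sub>R w) - t *\<^sub>R w = t *\<^sub>R (\<pi> \<gamma> w - w)"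
            using linear_scale[OF bounded_linear.linear[OF iso(3)]] by (simp add: scaleR_diff_right)
          then show ?thesis using t by simp
        qed
        then have "?F \<alpha> (p + t *\<^sub>R w) = weighted_mean K m r (\<lambda>\<gamma>. t * norm (\<pi> \<gamma> w - w))"
          unfolding F by (rule weighted_mean_cong)
        also have "\<dots> = t * ?F \<alpha> (p + w)"
          unfolding F using t by (intro weighted_mean_scale[OF wm]) auto
        finally show "?F \<alpha> (p + t *\<^sub>R w) = t * ?F \<alpha> (p + w)" .
      next
        show "v \<noteq> p"
        proof
          assume "v = p"
          have "?F \<alpha> (p + 0) = 0"
            unfolding F using weighted_mean_scale[OF wm, of 0 "\<lambda>\<gamma>. norm (\<pi> \<gamma> 0 - 0)"]
              weighted_mean_cong[of K "\<lambda>\<gamma>. norm (\<pi> \<gamma> 0 - 0)" "\<lambda>_. 0"] iso(1)[of _ 0] K(2)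
            by (simp add: subset_iff)
          with pos \<open>v = p\<close> show False by simp
        qed
        have "c * norm (v - p) \<le> C * (c * (\<Sum>\<gamma>\<in>K. norm (\<pi> \<gamma> (v - p) - (v - p))))"
          using C(2)[of "v - p"] c by (simp add: mult.left_commute)
        also have "\<dots> \<le> C * ?F \<alpha> v"
          using mean[of "\<lambda>\<gamma>. norm (\<pi> \<gamma> (v - p) - (v - p))"] F[of "v - p"] C(1) by simp
        finally show "c / C * norm (v - p) \<le> ?F \<alpha> v" using C(1) by (simp add: field_simps)
      qed
    qed
    moreover have "c / C > 0" using c C by simp
    ultimately show ?thesis by blast
  qed
  show ?thesis
  \<comment> \<open>The uniform bound implies the bound for each action, so \<open>uniform\<close>
    yields both (i) to (ii) and, after \<open>fixed\<close>, the supplement.\<close>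
  proof (intro conjI iffI impI)
    show ?fixed if "?local" using that fixed by blast
    show ?local if ?fixed using uniform[OF that] by blast
    show ?uniform if ?local using that fixed by (intro uniform) blast
  qed
qed

end
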